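(* Let $C_1$ and $C_2$ be clones on $\{0,1\}$. The lattices $\mathcal{L}_{(C_1,C_2)}$, $\mathcal{L}_{(C_1,C_2^{\mathrm{d}})}$, $\mathcal{L}_{(C_1^{\mathrm{d}},C_2)}$, and $\mathcal{L}_{(C_1^{\mathrm{d}},C_2^{\mathrm{d}})}$ all have the same cardinality.
   Context: A Boolean function is a map $f \colon \{0,1\}^n \to \{0,1\}$ for some integer $n \geq 1$ (its arity). If $f$ is $n$-ary and $g_1,\dots,g_n$ are $m$-ary, then $f(g_1,\dots,g_n)$ is the $m$-ary function $\mathbf{a} \mapsto f(g_1(\mathbf{a}),\dots,g_n(\mathbf{a}))$. For sets $F, G$ of Boolean functions, $FG$ is the set of all composites $f(g_1,\dots,g_n)$ with $f \in F$ of some arity $n$ and $g_1,\dots,g_n \in G$ all of a common arity. A clone on $\{0,1\}$ is a set $C$ of Boolean functions containing all projections and satisfying $CC \subseteq C$. For clones $C_1,C_2$ on $\{0,1\}$, a (possibly empty) set $K$ of Boolean functions is a $(C_1,C_2)$-clonoid if $KC_1 \subseteq K$ and $C_2K \subseteq K$; $\mathcal{L}_{(C_1,C_2)}$ is the lattice (under inclusion) of all $(C_1,C_2)$-clonoids. For an $n$-ary Boolean function $f$, its dual is $f^{\mathrm{d}}(a_1,\dots,a_n)=1-f(1-a_1,\dots,1-a_n)$. For a set $C$ of Boolean functions, $C^{\mathrm{d}}=\{f^{\mathrm{d}}: f\in C\}$. (The dual of a clone is again a clone.) *)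

theory Defs
  imports "HOL-Library.FuncSet" "HOL-Library.Equipollence"
begin

text \<open>
  The set \<open>{0,1}\<close> is the type \<^typ>\<open>bool\<close>, so that \<open>1 - x\<close> is \<open>\<not> x\<close>, and an \<open>n\<close>-tuple
  is a list of length \<open>n\<close>. A Boolean function is stored together with its arity. Its second
  component is required to be extensional (\<^const>\<open>undefined\<close> outside \<open>{0,1}\<^sup>n\<close>), so that every
  mathematical function has exactly one representative; this matters since sets of such
  functions are counted.
\<close>

type_synonym bfun = "nat \<times> (bool list \<Rightarrow> bool)"

abbreviation arity :: "bfun \<Rightarrow> nat" where
  "arity \<equiv> fst"

definition tuples :: "nat \<Rightarrow> bool list set" where
  "tuples n = {a. length a = n}"

definition boolean_functions :: "bfun set" where
  "boolean_functions = (SIGMA n : {1..}. tuples n \<rightarrow>\<^sub>E (UNIV :: bool set))"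

definition projection :: "nat \<Rightarrow> nat \<Rightarrow> bfun" where
  "projection n i = (n, \<lambda>a\<in>tuples n. a ! i)"

definition projections :: "bfun set" where
  "projections = {projection n i | n i. i < n}"

text \<open>\<open>composite m f [g\<^sub>1, \<dots>, g\<^sub>n]\<close> is \<open>f(g\<^sub>1, \<dots>, g\<^sub>n)\<close>, where \<open>m\<close> is the common arity of
  the \<open>g\<^sub>i\<close>.\<close>

definition composite :: "nat \<Rightarrow> bfun \<Rightarrow> bfun list \<Rightarrow> bfun" where
  "composite m f gs = (m, \<lambda>a\<in>tuples m. snd f (map (\<lambda>g. snd g a) gs))"

definition class_composition :: "bfun set \<Rightarrow> bfun set \<Rightarrow> bfun set" where
  "class_composition F G =
     {composite m f gs | m f gs.
        f \<in> F \<and> length gs = arity f \<and> set gs \<subseteq> G \<and> (\<forall>g\<in>set gs. arity g = m)}"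

definition clone :: "bfun set \<Rightarrow> bool" where
  "clone C \<longleftrightarrow>
     C \<subseteq> boolean_functions \<and> projections \<subseteq> C \<and> class_composition C C \<subseteq> C"

definition clonoid :: "bfun set \<Rightarrow> bfun set \<Rightarrow> bfun set \<Rightarrow> bool" where
  "clonoid C1 C2 K \<longleftrightarrow>
     K \<subseteq> boolean_functions \<and> class_composition K C1 \<subseteq> K \<and> class_composition C2 K \<subseteq> K"

text \<open>The underlying set of the lattice of clonoids; its order is \<open>\<subseteq>\<close>.\<close>

definition clonoids :: "bfun set \<Rightarrow> bfun set \<Rightarrow> bfun set set" where
  "clonoids C1 C2 = {K. clonoid C1 C2 K}"

definition dual :: "bfun \<Rightarrow> bfun" where
  "dual f = (arity f, \<lambda>a\<in>tuples (arity f). \<not> snd f (map Not a))"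

end

theory Submission
  imports Defs
begin

text \<open>
  Write \<open>f\<^sup>n\<close> for the negation of the output of \<open>f\<close> and \<open>f\<^sup>i\<close> for the negation of all its inputs.
  Then \<open>(f(g\<^sub>1, \<dots>))\<^sup>n = f\<^sup>n(g\<^sub>1, \<dots>) = f\<^sup>d(g\<^sub>1\<^sup>n, \<dots>)\<close> and
  \<open>(f(g\<^sub>1, \<dots>))\<^sup>i = f\<^sup>i(g\<^sub>1\<^sup>d, \<dots>) = f(g\<^sub>1\<^sup>i, \<dots>)\<close>. Hence \<open>K \<mapsto> K\<^sup>n\<close> dualizes the
  target clone and \<open>K \<mapsto> K\<^sup>i\<close> the source clone, and both maps are involutions.
\<close>

definition outer_neg :: "bfun \<Rightarrow> bfun" where
  "outer_neg f = (arity f, \<lambda>a\<in>tuples (arity f). \<not> snd f a)"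

definition inner_neg :: "bfun \<Rightarrow> bfun" where
  "inner_neg f = (arity f, \<lambda>a\<in>tuples (arity f). snd f (map Not a))"

lemma map_Not_Not [simp]: "map Not (map Not a) = a"
  by (simp add: comp_def)

lemma map_Not_in_tuples [simp]: "map Not a \<in> tuples n \<longleftrightarrow> a \<in> tuples n"
  by (simp add: tuples_def)

lemma arity_outer_neg [simp]: "arity (outer_neg f) = arity f"
  by (simp add: outer_neg_def)

lemma arity_inner_neg [simp]: "arity (inner_neg f) = arity f"
  by (simp add: inner_neg_def)

lemma arity_dual [simp]: "arity (dual f) = arity f"
  by (simp add: dual_def)

lemma snd_outer_neg [simp]: "length a = arity f \<Longrightarrow> snd (outer_neg f) a \<longleftrightarrow> \<not> snd f a"
  by (simp add: outer_neg_def tuples_def)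

lemma snd_inner_neg [simp]: "length a = arity f \<Longrightarrow> snd (inner_neg f) a \<longleftrightarrow> snd f (map Not a)"
  by (simp add: inner_neg_def tuples_def)

lemma snd_dual [simp]: "length a = arity f \<Longrightarrow> snd (dual f) a \<longleftrightarrow> \<not> snd f (map Not a)"
  by (simp add: dual_def tuples_def)

text \<open>Both second components are extensional, so outside \<open>tuples (arity f)\<close> they
  agree automatically.\<close>

lemma bfun_eqI:
  assumes "f \<in> boolean_functions" "g \<in> boolean_functions" "arity f = arity g"
    and "\<And>a. length a = arity f \<Longrightarrow> snd f a = snd g a"
  shows "f = g"
proof (rule prod_eqI)
  have "snd f \<in> tuples (arity f) \<rightarrow>\<^sub>E UNIV" "snd g \<in> tuples (arity f) \<rightarrow>\<^sub>E UNIV"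
    using assms(1-3) by (auto simp: boolean_functions_def)
  then show "snd f = snd g"
    by (rule PiE_ext) (simp add: assms(4) tuples_def)
qed (fact assms(3))

lemma outer_neg_in_boolean_functions:
  "f \<in> boolean_functions \<Longrightarrow> outer_neg f \<in> boolean_functions"
  by (auto simp: boolean_functions_def outer_neg_def)

lemma inner_neg_in_boolean_functions:
  "f \<in> boolean_functions \<Longrightarrow> inner_neg f \<in> boolean_functions"
  by (auto simp: boolean_functions_def inner_neg_def)

lemma dual_in_boolean_functions:
  "f \<in> boolean_functions \<Longrightarrow> dual f \<in> boolean_functions"
  by (auto simp: boolean_functions_def dual_def)

lemma outer_neg_outer_neg:
  "f \<in> boolean_functions \<Longrightarrow> outer_neg (outer_neg f) = f"
  by (rule bfun_eqI) (simp_all add: outer_neg_in_boolean_functions)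

lemma inner_neg_inner_neg:
  "f \<in> boolean_functions \<Longrightarrow> inner_neg (inner_neg f) = f"
  \<comment> \<open>\<open>map_map\<close> would fuse the double negation of the inputs before
    \<open>map_Not_Not\<close> can cancel it.\<close>
  by (rule bfun_eqI) (simp_all add: inner_neg_in_boolean_functions del: map_map)

lemma dual_dual:
  "f \<in> boolean_functions \<Longrightarrow> dual (dual f) = f"
  by (rule bfun_eqI) (simp_all add: dual_in_boolean_functions del: map_map)

lemma image_involution_on:
  assumes "K \<subseteq> B" "\<And>f. f \<in> B \<Longrightarrow> h (h f) = f"
  shows "h ` h ` K = K"
  using assms by (force simp: image_image)

context
  fixes m :: nat and f :: bfun and gs :: "bfun list"
  assumes len: "length gs = arity f" and ar: "\<forall>g\<in>set gs. arity g = m"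
begin

text \<open>By \<open>len\<close>, the outer function receives a tuple of its own arity, where its
  negated version is a genuine value and not \<open>undefined\<close>.\<close>

lemma composite_outer_neg: "composite m (outer_neg f) gs = outer_neg (composite m f gs)"
  using len by (auto simp: composite_def outer_neg_def tuples_def restrict_def fun_eq_iff)

lemma composite_dual_outer_neg:
  "composite m (dual f) (map outer_neg gs) = outer_neg (composite m f gs)"
proof -
  \<comment> \<open>The input negation inside \<open>dual f\<close> cancels the output negations of
    the inner functions; only the output negation of \<open>dual f\<close> survives.\<close>
  have "map Not (map (\<lambda>g. snd g a) (map outer_neg gs)) = map (\<lambda>g. snd g a) gs"
    if "length a = m" for a
    using ar that by simp
  then show ?thesis
    using len
    \<comment> \<open>The instance for pairs unfolds \<open>outer_neg\<close> only at the composite,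
      so that the inner functions keep the form of the fact above.\<close>
    by (auto simp: composite_def outer_neg_def[of "(_, _)"] tuples_def restrict_def fun_eq_iff
        simp del: map_map)
qed

lemma composite_inner_neg_dual:
  "composite m (inner_neg f) (map dual gs) = inner_neg (composite m f gs)"
proof -
  \<comment> \<open>Here the input negation of \<open>inner_neg f\<close> cancels the output
    negation in each \<open>dual g\<close>, which leaves \<open>g\<close> at the negated
    tuple.\<close>
  have "map Not (map (\<lambda>g. snd g a) (map dual gs)) = map (\<lambda>g. snd g (map Not a)) gs"
    if "length a = m" for a
    using ar that by simp
  then show ?thesis
    using len
    by (auto simp: composite_def inner_neg_def[of "(_, _)"] tuples_def restrict_def fun_eq_iff
        simp del: map_map)
qed

lemma composite_map_inner_neg:
  "composite m f (map inner_neg gs) = inner_neg (composite m f gs)"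
proof -
  have "map (\<lambda>g. snd g a) (map inner_neg gs) = map (\<lambda>g. snd g (map Not a)) gs"
    if "length a = m" for a
    using ar that by simp
  then show ?thesis
    by (auto simp: composite_def inner_neg_def[of "(_, _)"] tuples_def restrict_def fun_eq_iff
        simp del: map_map)
qed

end

text \<open>Lifts each identity between composites to sets of functions; taking \<open>p\<close> or
  \<open>q\<close> as the identity covers the cases where one factor is unchanged.\<close>

lemma class_composition_image_subset:
  assumes arity: "\<And>f. arity (p f) = arity f" "\<And>g. arity (q g) = arity g"
    and comp: "\<And>m f gs. length gs = arity f \<Longrightarrow> \<forall>g\<in>set gs. arity g = m \<Longrightarrow>
      composite m (p f) (map q gs) = r (composite m f gs)"
  shows "class_composition (p ` F) (q ` G) \<subseteq> r ` class_composition F G"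
proof
  fix h
  assume "h \<in> class_composition (p ` F) (q ` G)"
  then obtain m f gs' where h: "h = composite m (p f) gs'" "f \<in> F" "length gs' = arity (p f)"
    "set gs' \<subseteq> q ` G" "\<forall>g\<in>set gs'. arity g = m"
    unfolding class_composition_def by blast
  \<comment> \<open>Choosing a preimage under \<open>q\<close> for each entry gives a list over
    \<open>G\<close>; as \<open>p\<close> and \<open>q\<close> preserve arities, it can be composed
    with \<open>f\<close>.\<close>
  then have "gs' \<in> map q ` lists G"
    by (metis in_listsI lists_image subsetD)
  then obtain gs where gs: "gs' = map q gs" "set gs \<subseteq> G"
    by auto
  then have "length gs = arity f" "\<forall>g\<in>set gs. arity g = m"
    using h by (simp_all add: arity)
  with h gs have "composite m f gs \<in> class_composition F G" "h = r (composite m f gs)"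
    unfolding class_composition_def by (blast, simp add: comp)
  then show "h \<in> r ` class_composition F G"
    by blast
qed

lemma clonoid_subset: "clonoid C1 C2 K \<Longrightarrow> K \<subseteq> boolean_functions"
  by (simp add: clonoid_def)

lemma clonoid_outer_neg:
  assumes "clonoid C1 C2 K"
  shows "clonoid C1 (dual ` C2) (outer_neg ` K)"
  unfolding clonoid_def
proof (intro conjI)
  show "outer_neg ` K \<subseteq> boolean_functions"
    using clonoid_subset[OF assms] outer_neg_in_boolean_functions by blast
  have "class_composition (outer_neg ` K) C1 \<subseteq> outer_neg ` class_composition K C1"
    using class_composition_image_subset[of outer_neg "\<lambda>g. g" outer_neg K C1]
    by (simp add: composite_outer_neg)
  then show "class_composition (outer_neg ` K) C1 \<subseteq> outer_neg ` K"
    using assms unfolding clonoid_def by blast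
  have "class_composition (dual ` C2) (outer_neg ` K) \<subseteq> outer_neg ` class_composition C2 K"
    by (rule class_composition_image_subset)
      (simp_all only: arity_dual arity_outer_neg composite_dual_outer_neg)
  then show "class_composition (dual ` C2) (outer_neg ` K) \<subseteq> outer_neg ` K"
    using assms unfolding clonoid_def by blast
qed

lemma clonoid_inner_neg:
  assumes "clonoid C1 C2 K"
  shows "clonoid (dual ` C1) C2 (inner_neg ` K)"
  unfolding clonoid_def
proof (intro conjI)
  show "inner_neg ` K \<subseteq> boolean_functions"
    using clonoid_subset[OF assms] inner_neg_in_boolean_functions by blast
  have "class_composition (inner_neg ` K) (dual ` C1) \<subseteq> inner_neg ` class_composition K C1"
    by (rule class_composition_image_subset)
      (simp_all only: arity_dual arity_inner_neg composite_inner_neg_dual)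
  then show "class_composition (inner_neg ` K) (dual ` C1) \<subseteq> inner_neg ` K"
    using assms unfolding clonoid_def by blast
  have "class_composition C2 (inner_neg ` K) \<subseteq> inner_neg ` class_composition C2 K"
    using class_composition_image_subset[of "\<lambda>f. f" inner_neg inner_neg C2 K]
    by (simp add: composite_map_inner_neg)
  then show "class_composition C2 (inner_neg ` K) \<subseteq> inner_neg ` K"
    using assms unfolding clonoid_def by blast
qed

text \<open>Taking images under \<open>h\<close> is its own inverse on sets of Boolean functions, so
  the same map witnesses both directions of the bijection.\<close>

lemma clonoids_eqpoll_involution:
  assumes "\<And>f. f \<in> boolean_functions \<Longrightarrow> h (h f) = f"
    and "\<And>K. clonoid C1 C2 K \<Longrightarrow> clonoid D1 D2 (h ` K)"
    and "\<And>K. clonoid D1 D2 K \<Longrightarrow> clonoid C1 C2 (h ` K)"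
  shows "clonoids C1 C2 \<approx> clonoids D1 D2"
proof -
  have "h ` h ` K = K" if "K \<subseteq> boolean_functions" for K
    using that assms(1) by (rule image_involution_on)
  then have "bij_betw ((`) h) (clonoids C1 C2) (clonoids D1 D2)"
    using assms(2,3) clonoid_subset
    by (intro bij_betw_byWitness[where f' = "(`) h"]) (force simp: clonoids_def simp del: image_image)+
  then show ?thesis
    by (auto simp: eqpoll_def)
qed

lemma clonoids_eqpoll_dual_target:
  assumes "C2 \<subseteq> boolean_functions"
  shows "clonoids C1 C2 \<approx> clonoids C1 (dual ` C2)"
  using outer_neg_outer_neg clonoid_outer_neg
proof (rule clonoids_eqpoll_involution)
  \<comment> \<open>Going back yields the target \<open>dual\<close> dual \<open>C2\<close>, which
    is \<open>C2\<close> because \<open>dual\<close> is an involution on Boolean functions.\<close>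
  show "clonoid C1 C2 (outer_neg ` K)" if "clonoid C1 (dual ` C2) K" for K
    using clonoid_outer_neg[OF that] image_involution_on[OF assms dual_dual] by simp
qed

lemma clonoids_eqpoll_dual_source:
  assumes "C1 \<subseteq> boolean_functions"
  shows "clonoids C1 C2 \<approx> clonoids (dual ` C1) C2"
  using inner_neg_inner_neg clonoid_inner_neg
proof (rule clonoids_eqpoll_involution)
  show "clonoid C1 C2 (inner_neg ` K)" if "clonoid (dual ` C1) C2 K" for K
    using clonoid_inner_neg[OF that] image_involution_on[OF assms dual_dual] by simp
qed

theorem corollary3p6:
  fixes C1 C2 :: "bfun set"
  assumes "clone C1" and "clone C2"
  shows "clonoids C1 C2 \<approx> clonoids C1 (dual ` C2) \<and>
         clonoids C1 C2 \<approx> clonoids (dual ` C1) C2 \<and>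
         clonoids C1 C2 \<approx> clonoids (dual ` C1) (dual ` C2)"
proof -
  have "C1 \<subseteq> boolean_functions" "C2 \<subseteq> boolean_functions"
    using assms by (simp_all add: clone_def)
  then show ?thesis
    \<comment> \<open>Each lemma constrains only the clone that it dualizes, so the two chain to
      dualize both clones.\<close>
    by (meson clonoids_eqpoll_dual_source clonoids_eqpoll_dual_target eqpoll_trans)
qed

end
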